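(* Every left-affine system of equations $\mathcal{S}=\langle M,p,b,r\rangle$ on a finite set $Q$ of unknowns admits a $\equiv$-solution $h:Q\to\mathsf{Exp}$, and this solution is unique up to $\equiv$: if $h,g:Q\to\mathsf{Exp}$ are both $\equiv$-solutions of $\mathcal{S}$ then $h(q)\equiv g(q)$ for all $q\in Q$.
   Context: Fix a finite alphabet $A$. Probabilistic regular expressions: $e,f ::= \mathsf{0}\mid\mathsf{1}\mid a\ (a\in A)\mid e\oplus_pf\mid e;f\mid e^{[p]}$, $p\in[0,1]$; $\mathsf{Exp}$ is the set of them. Termination $E:\mathsf{Exp}\to[0,1]$: $E(\mathsf{1})=1$, $E(\mathsf{0})=E(a)=0$, $E(e\oplus_pf)=pE(e)+(1-p)E(f)$, $E(e;f)=E(e)E(f)$, $E(e^{[p]})=0$ if $E(e)=1,p=1$, else $\frac{1-p}{1-pE(e)}$. $\bar p=1-p$. $\equiv$ is the least congruence on $\mathsf{Exp}$ containing, for all $e,f,g$, $p,q$ (division instances only for nonzero denominators): (C1) $e\equiv e\oplus_pe$; (C2) $e\equiv e\oplus_1f$; (C3) $e\oplus_pf\equiv f\oplus_{\bar p}e$; (C4) $(e\oplus_pf)\oplus_qg\equiv e\oplus_{pq}(f\oplus_{\frac{\bar pq}{1-pq}}g)$; (D1) $(e\oplus_pf);g\equiv e;g\oplus_pf;g$; (D2) $e;(f\oplus_pg)\equiv e;f\oplus_pe;g$; (0S) $\mathsf{0};e\equiv\mathsf{0}$; (S0) $e;\mathsf{0}\equiv\mathsf{0}$; (1S) $\mathsf{1};e\equiv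 e$; (S1) $e;\mathsf{1}\equiv e$; (S) $e;(f;g)\equiv(e;f);g$; (Unroll) $e;e^{[p]}\oplus_p\mathsf{1}\equiv e^{[p]}$; (Tight) $(e\oplus_p\mathsf{1})^{[q]};\mathsf{1}\equiv e^{[\frac{pq}{1-\bar pq}]}$; (Div) $\mathsf{1}^{[1]}\equiv\mathsf{0}$; closed under (Unique): if $g\equiv e;g\oplus_pf$ and $E(e)=0$ then $g\equiv e^{[p]};f$. $n$-ary choice: for finite $I$, $p_i\in[0,1]$ with $\sum p_i\le1$, $\bigoplus_{i\in I}p_i\cdot e_i$ is $\mathsf{0}$ if $I=\emptyset$; $e_k$ if some $p_k=1$; otherwise $e_k\oplus_{p_k}\big(\bigoplus_{i\ne k}\frac{p_i}{1-p_k}\cdot e_i\big)$ for a chosen $k$. A juxtaposition $\bigoplus_{i\in I}p_i\cdot e_i\oplus\bigoplus_{j\in J}q_j\cdot f_j$ denotes the single $n$-ary choice over $I+J$. A left-affine system on a finite set $Q$ of unknowns is $\mathcal{S}=\langle M:Q\times Q\to\mathsf{Exp},\ p:Q\times Q\to[0,1],\ b:Q\to\mathsf{Exp},\ r:Q\to[0,1]\rangle$ such that for all $q,q'\in Q$: $\sum_{q''\in Q}p_{q,q''}+r_q=1$ and $E(M_{q,q'})=0$. A map $h:Q\to\mathsf{Exp}$ is a $\equiv$-solution if for all $q\in Q$: $h(q)\equiv\big(\bigoplus_{q'\in Q}p_{q,q'}\cdot M_{q,q'};h(q')\big)\oplus r_q\cdot b_q$. *)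

theory Defs
  imports Complex_Main
begin

typedef prob = "{0..1::real}"
  morphisms val prb
  by auto

datatype 'a pexp =
    Zero
  | One
  | Act 'a
  | Choice prob "'a pexp" "'a pexp"
  | Seq "'a pexp" "'a pexp"  (infixr \<open>;;\<close> 75)
  | Loop "'a pexp" prob

abbreviation choice :: "'a pexp \<Rightarrow> prob \<Rightarrow> 'a pexp \<Rightarrow> 'a pexp"
    (\<open>_ \<oplus>\<^bsub>_\<^esub>/ _\<close> [66, 0, 65] 65) where
  "e \<oplus>\<^bsub>p\<^esub> f \<equiv> Choice p e f"

primrec E :: "'a pexp \<Rightarrow> real" where
  "E Zero = 0"
| "E One = 1"
| "E (Act a) = 0"
| "E (Choice p e f) = val p * E e + (1 - val p) * E f"
| "E (e ;; f) = E e * E f"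
| "E (Loop e p) =
     (if E e = 1 \<and> val p = 1 then 0 else (1 - val p) / (1 - val p * E e))"

lemma E_bounds: "0 \<le> E e \<and> E e \<le> 1"
proof (induction e)
  case (Choice p e f)
  have p: "0 \<le> val p" "val p \<le> 1" using val[of p] by auto
  have "val p * E e + (1 - val p) * E f \<le> val p * 1 + (1 - val p) * 1"
    using Choice p by (intro add_mono mult_left_mono) auto
  with Choice p show ?case by auto
next
  case (Seq e f)
  then show ?case by (auto intro: mult_le_one)
next
  case (Loop e p)
  have p: "0 \<le> val p" "val p \<le> 1" using val[of p] by auto
  have "val p * E e \<le> val p * 1"
    using Loop p by (intro mult_left_mono) auto
  with p show ?case by (auto simp: divide_le_eq_1)
qed auto

text \<open>The arguments of \<^const>\<open>prb\<close> below always lie in the unit interval.\<close>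

inductive pequiv :: "'a pexp \<Rightarrow> 'a pexp \<Rightarrow> bool"  (infix \<open>\<simeq>\<close> 50) where
  Refl: "e \<simeq> e"
| Sym: "e \<simeq> f \<Longrightarrow> f \<simeq> e"
| Trans: "e \<simeq> f \<Longrightarrow> f \<simeq> g \<Longrightarrow> e \<simeq> g"
| cong_Choice: "e \<simeq> e' \<Longrightarrow> f \<simeq> f' \<Longrightarrow> e \<oplus>\<^bsub>p\<^esub> f \<simeq> e' \<oplus>\<^bsub>p\<^esub> f'"
| cong_Seq: "e \<simeq> e' \<Longrightarrow> f \<simeq> f' \<Longrightarrow> e ;; f \<simeq> e' ;; f'"
| cong_Loop: "e \<simeq> e' \<Longrightarrow> Loop e p \<simeq> Loop e' p"
| C1: "e \<simeq> e \<oplus>\<^bsub>p\<^esub> e"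
| C2: "e \<simeq> e \<oplus>\<^bsub>prb 1\<^esub> f"
| C3: "e \<oplus>\<^bsub>p\<^esub> f \<simeq> f \<oplus>\<^bsub>prb (1 - val p)\<^esub> e"
| C4: "1 - val p * val q \<noteq> 0 \<Longrightarrow>
    (e \<oplus>\<^bsub>p\<^esub> f) \<oplus>\<^bsub>q\<^esub> g \<simeq>
    e \<oplus>\<^bsub>prb (val p * val q)\<^esub> (f \<oplus>\<^bsub>prb ((1 - val p) * val q / (1 - val p * val q))\<^esub> g)"
| D1: "(e \<oplus>\<^bsub>p\<^esub> f) ;; g \<simeq> (e ;; g) \<oplus>\<^bsub>p\<^esub> (f ;; g)"
| D2: "e ;; (f \<oplus>\<^bsub>p\<^esub> g) \<simeq> (e ;; f) \<oplus>\<^bsub>p\<^esub> (e ;; g)"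
| ZeroSeq: "Zero ;; e \<simeq> Zero"
| SeqZero: "e ;; Zero \<simeq> Zero"
| OneSeq: "One ;; e \<simeq> e"
| SeqOne: "e ;; One \<simeq> e"
| Assoc: "e ;; (f ;; g) \<simeq> (e ;; f) ;; g"
| Unroll: "(e ;; Loop e p) \<oplus>\<^bsub>p\<^esub> One \<simeq> Loop e p"
| Tight: "1 - (1 - val p) * val q \<noteq> 0 \<Longrightarrow>
    Loop (e \<oplus>\<^bsub>p\<^esub> One) q ;; One \<simeq> Loop e (prb (val p * val q / (1 - (1 - val p) * val q)))"
| Div: "Loop One (prb 1) \<simeq> Zero"
| Unique: "g \<simeq> (e ;; g) \<oplus>\<^bsub>p\<^esub> f \<Longrightarrow> E e = 0 \<Longrightarrow> g \<simeq> Loop e p ;; f"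

text \<open>Finite choice is meant for finite \<open>I\<close> with weights summing to at most 1; then the rescaled
  weights are again probabilities with sum at most 1, and an index of weight 1 is the only index
  of nonzero weight. The index split off first is left unspecified.\<close>

function nchoice :: "'i set \<Rightarrow> ('i \<Rightarrow> prob) \<Rightarrow> ('i \<Rightarrow> 'a pexp) \<Rightarrow> 'a pexp" where
  "nchoice I p e =
    (if infinite I \<or> I = {} then Zero
     else if \<exists>k\<in>I. val (p k) = 1 then e (SOME k. k \<in> I \<and> val (p k) = 1)
     else let k = (SOME k. k \<in> I) in
       e k \<oplus>\<^bsub>p k\<^esub> nchoice (I - {k}) (\<lambda>i. prb (val (p i) / (1 - val (p k)))) e)"
  by pat_completeness auto
termination
  by (relation "measure (\<lambda>(I, _). card I)") (auto simp: some_in_eq card_gt_0_iff intro!: diff_less)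

declare nchoice.simps [simp del]

definition left_affine ::
  "'q set \<Rightarrow> ('q \<Rightarrow> 'q \<Rightarrow> 'a pexp) \<Rightarrow> ('q \<Rightarrow> 'q \<Rightarrow> prob) \<Rightarrow> ('q \<Rightarrow> 'a pexp) \<Rightarrow> ('q \<Rightarrow> prob) \<Rightarrow> bool"
  where
  "left_affine Q M p b r \<longleftrightarrow>
    (\<forall>q\<in>Q. (\<Sum>q''\<in>Q. val (p q q'')) + val (r q) = 1) \<and>
    (\<forall>q\<in>Q. \<forall>q'\<in>Q. E (M q q') = 0)"

text \<open>The right-hand side of each equation is one finite choice over the disjoint sum of \<open>Q\<close> and a
  singleton.\<close>

definition is_solution ::
  "'q set \<Rightarrow> ('q \<Rightarrow> 'q \<Rightarrow> 'a pexp) \<Rightarrow> ('q \<Rightarrow> 'q \<Rightarrow> prob) \<Rightarrow> ('q \<Rightarrow> 'a pexp) \<Rightarrow> ('q \<Rightarrow> prob) \<Rightarrow>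
    ('q \<Rightarrow> 'a pexp) \<Rightarrow> bool"
  where
  "is_solution Q M p b r h \<longleftrightarrow>
    (\<forall>q\<in>Q. h q \<simeq>
      nchoice (Q <+> {()})
        (case_sum (\<lambda>q'. p q q') (\<lambda>_. r q))
        (case_sum (\<lambda>q'. M q q' ;; h q') (\<lambda>_. b q)))"

end

theory Submission
  imports Defs
begin

text \<open>Two expressions built by probabilistic choice from the same family with the same total
  weights are equivalent by the convex algebra axioms (C1)-(C4), so right-hand sides of equations
  can be compared by comparing weights. Unknowns are then eliminated one at a time: in the equation
  of \<open>u\<close>, the axiom (Unique) turns \<open>h u \<simeq> (M u u ;; h u) \<oplus> F\<close> into
  \<open>h u \<simeq> Loop (M u u) (p u u) ;; F\<close>, and substituting this in the other equations gives a
  left-affine system in fewer unknowns with the same solutions. The equivalence of the two systems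
  yields existence and uniqueness together.\<close>

declare Trans [trans]

section \<open>Passing between probabilities and reals\<close>

lemma val_prb [simp]: "0 \<le> a \<Longrightarrow> a \<le> 1 \<Longrightarrow> val (prb a) = a"
  by (rule prb_inverse) auto

lemma val_nonneg [simp]: "0 \<le> val p" and val_le_1 [simp]: "val p \<le> 1"
  using val[of p] by auto

lemma prb_val [simp]: "prb (val p) = p"
  by (rule val_inverse)

section \<open>Binary choice\<close>

lemma choice_0: "e \<oplus>\<^bsub>prb 0\<^esub> f \<simeq> f"
proof -
  have "e \<oplus>\<^bsub>prb 0\<^esub> f \<simeq> f \<oplus>\<^bsub>prb 1\<^esub> e" using C3[of "prb 0" e f] by simp
  also have "\<dots> \<simeq> f" by (rule Sym[OF C2])
  finally show ?thesis .
qed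

lemma choice_1: "e \<oplus>\<^bsub>prb 1\<^esub> f \<simeq> e"
  by (rule Sym[OF C2])

lemma choice_assoc:
  assumes "0 \<le> p" "p \<le> 1" "0 \<le> q" "q \<le> 1" "p * q \<noteq> 1" "s = p * q" "t = (1 - p) * q / (1 - p * q)"
  shows "(e \<oplus>\<^bsub>prb p\<^esub> f) \<oplus>\<^bsub>prb q\<^esub> g \<simeq> e \<oplus>\<^bsub>prb s\<^esub> (f \<oplus>\<^bsub>prb t\<^esub> g)"
  using C4[of "prb p" "prb q" e f g] assms by simp

text \<open>(C4) read from right to left: \<open>q\<close> is the total weight of \<open>e\<close>
  and \<open>f\<close>, and \<open>s / q\<close> is the share of \<open>e\<close> in it.\<close>

lemma choice_assoc_inv:
  assumes "0 \<le> s" "s < 1" "0 \<le> t" "t \<le> 1" "q = s + (1 - s) * t" "q \<noteq> 0"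
  shows "e \<oplus>\<^bsub>prb s\<^esub> (f \<oplus>\<^bsub>prb t\<^esub> g) \<simeq> (e \<oplus>\<^bsub>prb (s / q)\<^esub> f) \<oplus>\<^bsub>prb q\<^esub> g"
proof -
  have 0: "0 \<le> (1 - s) * t" "(1 - s) * t \<le> 1 - s"
    using assms by (auto intro: mult_left_le)
  then have q: "0 < q" "q \<le> 1" "s \<le> q" using assms by linarith+
  have "(1 - s / q) * q = (1 - s) * t" using q assms(5) by (simp add: left_diff_distrib)
  then have t: "t = (1 - s / q) * q / (1 - s / q * q)" using q assms by simp
  show ?thesis
    by (rule Sym[OF choice_assoc[OF _ _ _ _ _ _ t]]) (use q assms(1,2) in auto)
qed

text \<open>Bracket \<open>e\<close> and \<open>f\<close> together, exchange them by (C3) and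
  rebracket. The new outer weight is the total weight of \<open>f\<close>.\<close>

lemma choice_swap:
  assumes "0 \<le> s" "s \<le> 1" "0 \<le> t" "t \<le> 1" "u = (1 - s) * t" "u \<noteq> 1" "v = s / (1 - u)"
  shows "e \<oplus>\<^bsub>prb s\<^esub> (f \<oplus>\<^bsub>prb t\<^esub> g) \<simeq> f \<oplus>\<^bsub>prb u\<^esub> (e \<oplus>\<^bsub>prb v\<^esub> g)"
proof -
  define q where "q = s + (1 - s) * t"
  have 0: "0 \<le> (1 - s) * t" "(1 - s) * t \<le> 1 - s"
    using assms by (auto intro: mult_left_le)
  \<comment> \<open>Rebracketing needs \<open>s < 1\<close> and a nonzero total weight
    \<open>q\<close> of \<open>e\<close> and \<open>f\<close>. In the degenerate cases both sides
    collapse to \<open>e\<close> and to \<open>g\<close>, respectively.\<close>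
  consider "s = 1" | "q = 0" | "s < 1" "q \<noteq> 0" using assms by fastforce
  then show ?thesis
  proof cases
    case 1
    have "e \<oplus>\<^bsub>prb 1\<^esub> (f \<oplus>\<^bsub>prb t\<^esub> g) \<simeq> e" by (rule choice_1)
    also have "e \<simeq> e \<oplus>\<^bsub>prb 1\<^esub> g" by (rule C2)
    also have "\<dots> \<simeq> f \<oplus>\<^bsub>prb 0\<^esub> (e \<oplus>\<^bsub>prb 1\<^esub> g)" by (rule Sym[OF choice_0])
    finally show ?thesis using 1 assms by simp
  next
    case 2
    then have [simp]: "s = 0" using assms 0 unfolding q_def by linarith
    with 2 have [simp]: "t = 0" "u = 0" "v = 0" using assms by (auto simp: q_def)
    have "e \<oplus>\<^bsub>prb 0\<^esub> (f \<oplus>\<^bsub>prb 0\<^esub> g) \<simeq> g" by (rule Trans[OF choice_0 choice_0])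
    also have "g \<simeq> f \<oplus>\<^bsub>prb 0\<^esub> (e \<oplus>\<^bsub>prb 0\<^esub> g)" by (rule Sym[OF Trans[OF choice_0 choice_0]])
    finally show ?thesis by simp
  next
    case 3
    then have q: "0 < q" "q \<le> 1" "s \<le> q" using assms 0 unfolding q_def by linarith+
    have "e \<oplus>\<^bsub>prb s\<^esub> (f \<oplus>\<^bsub>prb t\<^esub> g) \<simeq> (e \<oplus>\<^bsub>prb (s / q)\<^esub> f) \<oplus>\<^bsub>prb q\<^esub> g"
      by (rule choice_assoc_inv) (use assms(1-4) 3 q q_def in auto)
    also have "\<dots> \<simeq> (f \<oplus>\<^bsub>prb (1 - s / q)\<^esub> e) \<oplus>\<^bsub>prb q\<^esub> g"
      by (rule cong_Choice[OF _ Refl]) (use C3[of "prb (s / q)" e f] q assms(1,2) in auto)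
    also have "\<dots> \<simeq> f \<oplus>\<^bsub>prb u\<^esub> (e \<oplus>\<^bsub>prb v\<^esub> g)"
    proof (rule choice_assoc)
      have u: "(1 - s / q) * q = u" using q assms(5) by (simp add: left_diff_distrib q_def)
      then show "u = (1 - s / q) * q" "(1 - s / q) * q \<noteq> 1" using assms by auto
      show "v = (1 - (1 - s / q)) * q / (1 - (1 - s / q) * q)"
        unfolding u using q assms(7) by simp
    qed (use q assms(1,2) in auto)
    finally show ?thesis .
  qed
qed

text \<open>Reassociating and then swapping \<open>e\<close> with the second \<open>x\<close> brings
  both copies of \<open>x\<close> to the front, where (C1) fuses them. Here \<open>w\<close> is the
  total weight of \<open>x\<close>, and \<open>t\<close> is the share of \<open>e\<close> in the
  rest.\<close>

lemma choice_common:
  assumes "0 \<le> a" "a \<le> 1" "0 \<le> b" "b \<le> 1" "0 \<le> p" "p \<le> 1"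
    and w: "w = a * p + (1 - p) * b" "w < 1" and t: "t = (1 - a) * p / (1 - w)"
  shows "(x \<oplus>\<^bsub>prb a\<^esub> e) \<oplus>\<^bsub>prb p\<^esub> (x \<oplus>\<^bsub>prb b\<^esub> f) \<simeq> x \<oplus>\<^bsub>prb w\<^esub> (e \<oplus>\<^bsub>prb t\<^esub> f)"
proof -
  \<comment> \<open>\<open>s\<close> is the inner weight that (C4) yields; \<open>u\<close> is the
    weight of the second \<open>x\<close> once it stands in front of \<open>e\<close>.\<close>
  define s where "s = (1 - a) * p / (1 - a * p)"
  define u where "u = (1 - s) * b"
  have 0: "0 \<le> (1 - p) * b" "0 \<le> a * p" "0 \<le> (1 - a) * p" using assms by auto
  have ap: "a * p < 1" using 0 w by linarith
  have s: "0 \<le> s" "s \<le> 1" using 0 ap \<open>p \<le> 1\<close> by (auto simp: s_def divide_le_eq_1 left_diff_distrib)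
  have s1: "1 - s = (1 - p) / (1 - a * p)" using ap by (simp add: s_def divide_simps) (simp add: left_diff_distrib)
  have u_eq: "u = (1 - p) * b / (1 - a * p)" by (simp add: u_def s1)
  have "1 - u = ((1 - a * p) - (1 - p) * b) / (1 - a * p)"
    using ap by (simp add: u_eq diff_divide_distrib)
  then have u1: "1 - u = (1 - w) / (1 - a * p)" unfolding w(1) by (simp add: diff_diff_eq)
  moreover have "0 < (1 - w) / (1 - a * p)" using w ap by simp
  ultimately have "u < 1" by linarith
  moreover have "0 \<le> u" using ap 0 by (simp add: u_eq)
  ultimately have u: "0 \<le> u" "u < 1" by auto
  have t_eq: "t = s / (1 - u)" unfolding u1 t s_def using ap w(2) by simp
  have w_eq: "w = a * p + (1 - a * p) * u" using ap unfolding u_eq w(1) by simp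
  have "(x \<oplus>\<^bsub>prb a\<^esub> e) \<oplus>\<^bsub>prb p\<^esub> (x \<oplus>\<^bsub>prb b\<^esub> f) \<simeq> x \<oplus>\<^bsub>prb (a * p)\<^esub> (e \<oplus>\<^bsub>prb s\<^esub> (x \<oplus>\<^bsub>prb b\<^esub> f))"
    by (rule choice_assoc) (use assms(1-6) ap s_def in simp_all)
  also have "\<dots> \<simeq> x \<oplus>\<^bsub>prb (a * p)\<^esub> (x \<oplus>\<^bsub>prb u\<^esub> (e \<oplus>\<^bsub>prb t\<^esub> f))"
    by (intro cong_Choice[OF Refl] choice_swap[OF s assms(3,4) u_def _ t_eq]) (use u in simp)
  also have "\<dots> \<simeq> x \<oplus>\<^bsub>prb w\<^esub> (e \<oplus>\<^bsub>prb t\<^esub> f)"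
  proof (cases "w = 0")
    \<comment> \<open>Fusing would divide by \<open>w\<close>; instead both copies of
      \<open>x\<close> have weight 0, and \<open>choice_0\<close> drops the outer one.\<close>
    case True
    then have "a * p = 0" "(1 - p) * b = 0" using 0 w(1) by linarith+
    then have "a * p = 0" "u = 0" by (simp_all add: u_eq)
    then show ?thesis using True by (simp only: choice_0)
  next
    case False
    have "x \<oplus>\<^bsub>prb (a * p)\<^esub> (x \<oplus>\<^bsub>prb u\<^esub> (e \<oplus>\<^bsub>prb t\<^esub> f)) \<simeq>
        (x \<oplus>\<^bsub>prb (a * p / w)\<^esub> x) \<oplus>\<^bsub>prb w\<^esub> (e \<oplus>\<^bsub>prb t\<^esub> f)"
      by (rule choice_assoc_inv) (use 0(2) ap u w_eq False in simp_all)
    also have "\<dots> \<simeq> x \<oplus>\<^bsub>prb w\<^esub> (e \<oplus>\<^bsub>prb t\<^esub> f)"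
      by (rule cong_Choice[OF Sym[OF C1] Refl])
    finally show ?thesis .
  qed
  finally show ?thesis .
qed

section \<open>Convex combinations of finite families\<close>

text \<open>Trees of binary choices with leaves \<open>x i\<close>, where \<open>w i\<close> is the
  total weight of the leaves labelled \<open>i\<close>. Building \<open>\<simeq>\<close> into both
  rules forgets the shape of the tree. Weights are real and matter only on \<open>I\<close>, so they
  can be computed with directly.\<close>

inductive mix :: "'i set \<Rightarrow> ('i \<Rightarrow> 'a pexp) \<Rightarrow> ('i \<Rightarrow> real) \<Rightarrow> 'a pexp \<Rightarrow> bool"
  for I x where
  leaf: "i \<in> I \<Longrightarrow> e \<simeq> x i \<Longrightarrow> (\<And>j. j \<in> I \<Longrightarrow> w j = of_bool (j = i)) \<Longrightarrow> mix I x w e"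
| node: "mix I x u e \<Longrightarrow> mix I x v f \<Longrightarrow> g \<simeq> e \<oplus>\<^bsub>p\<^esub> f \<Longrightarrow>
    (\<And>j. j \<in> I \<Longrightarrow> w j = val p * u j + (1 - val p) * v j) \<Longrightarrow> mix I x w g"

lemma mix_equiv: "mix I x w e \<Longrightarrow> f \<simeq> e \<Longrightarrow> mix I x w f"
  by (induction rule: mix.cases) (auto intro: mix.intros Trans)

lemma mix_weight_cong: "mix I x w e \<Longrightarrow> (\<And>i. i \<in> I \<Longrightarrow> w' i = w i) \<Longrightarrow> mix I x w' e"
  by (induction rule: mix.cases) (auto intro: mix.intros)

lemma mix_mono:
  "mix I x w e \<Longrightarrow> I \<subseteq> J \<Longrightarrow> (\<And>j. j \<in> I \<Longrightarrow> w' j = w j) \<Longrightarrow> (\<And>j. j \<in> J - I \<Longrightarrow> w' j = 0) \<Longrightarrow>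
    mix J x w' e"
proof (induction arbitrary: w' rule: mix.induct)
  case (leaf i e w)
  have "w' j = of_bool (j = i)" if "j \<in> J" for j
    using leaf that by (cases "j \<in> I") auto
  then show ?case using leaf by (intro mix.leaf[of i]) auto
next
  case (node u e v f g p w)
  have 1: "mix J x (\<lambda>j. if j \<in> I then u j else 0) e" "mix J x (\<lambda>j. if j \<in> I then v j else 0) f"
    using node by auto
  show ?case by (rule mix.node[OF 1 node(3)]) (use node in auto)
qed

lemma mix_nonneg: "mix I x w e \<Longrightarrow> i \<in> I \<Longrightarrow> 0 \<le> w i"
  by (induction rule: mix.induct) auto

lemma mix_sum: "mix I x w e \<Longrightarrow> finite I \<Longrightarrow> sum w I = 1"
proof (induction rule: mix.induct)
  case (leaf i e w)
  then have "sum w I = (\<Sum>j\<in>I. of_bool (j = i))" by (intro sum.cong) auto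
  then show ?case using leaf by (simp add: of_bool_def sum.delta)
next
  case (node u e v f g p w)
  then have "sum w I = val p * sum u I + (1 - val p) * sum v I"
    by (simp add: sum.distrib flip: sum_distrib_left)
  then show ?case using node by simp
qed

section \<open>Finite probability distributions\<close>

lemma sum_1_concentrated:
  fixes w :: "'i \<Rightarrow> real"
  assumes "finite I" "sum w I = 1" "\<And>i. i \<in> I \<Longrightarrow> 0 \<le> w i" "k \<in> I" "w k = 1" "j \<in> I" "j \<noteq> k"
  shows "w j = 0"
proof -
  have "sum w (I - {k}) = 0" using assms by (simp add: sum_diff1)
  then show ?thesis using assms by (subst (asm) sum_nonneg_eq_0_iff) auto
qed

lemma weight_le_1:
  fixes w :: "'i \<Rightarrow> real"
  assumes "finite I" "sum w I = 1" "\<And>i. i \<in> I \<Longrightarrow> 0 \<le> w i" "i \<in> I"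
  shows "w i \<le> 1"
  using member_le_sum[of i I w] assms by auto

section \<open>Operations on convex combinations and their uniqueness\<close>

lemma mix_seq_left:
  "mix I x w e \<Longrightarrow> (\<And>i. i \<in> I \<Longrightarrow> y i \<simeq> f ;; x i) \<Longrightarrow> mix I y w (f ;; e)"
proof (induction rule: mix.induct)
  case (leaf i e w)
  show ?case by (rule mix.leaf[of i]) (use leaf in \<open>auto intro: Trans[OF cong_Seq[OF Refl] Sym]\<close>)
next
  case (node u e1 v e2 g p w)
  have "f ;; g \<simeq> (f ;; e1) \<oplus>\<^bsub>p\<^esub> (f ;; e2)"
    by (rule Trans[OF cong_Seq[OF Refl node(3)] D2])
  then show ?case by (rule mix.node[rotated 2]) (use node in auto)
qed

lemma mix_cong:
  "mix I x w e \<Longrightarrow> (\<And>i. i \<in> I \<Longrightarrow> x i \<simeq> y i) \<Longrightarrow> mix I y w e"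
proof (induction rule: mix.induct)
  case (leaf i e w)
  show ?case by (rule mix.leaf[of i]) (use leaf in \<open>auto intro: Trans\<close>)
next
  case (node u e1 v e2 g p w)
  then show ?case by (auto intro: mix.node)
qed

text \<open>Grafting a tree for \<open>x i\<close> onto each leaf \<open>i\<close> multiplies
  weights along paths, hence the matrix product in the new weights.\<close>

lemma mix_flatten:
  "mix I x w e \<Longrightarrow> finite I \<Longrightarrow> (\<And>i. i \<in> I \<Longrightarrow> mix J y (v i) (x i)) \<Longrightarrow>
    (\<And>j. j \<in> J \<Longrightarrow> w' j = (\<Sum>i\<in>I. w i * v i j)) \<Longrightarrow> mix J y w' e"
proof (induction arbitrary: w' rule: mix.induct)
  case (leaf i e w)
  have "w' j = v i j" if "j \<in> J" for j
  proof -
    have "w' j = (\<Sum>k\<in>I. if k = i then v k j else 0)"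
      unfolding leaf.prems(3)[OF that] by (intro sum.cong) (auto simp: leaf)
    then show ?thesis using leaf by simp
  qed
  then show ?case using leaf by (metis mix_equiv mix_weight_cong)
next
  case (node u e1 v' e2 g p w)
  show ?case
  proof (rule mix.node)
    show "mix J y (\<lambda>j. \<Sum>i\<in>I. u i * v i j) e1" "mix J y (\<lambda>j. \<Sum>i\<in>I. v' i * v i j) e2"
      using node by auto
    show "w' j = val p * (\<Sum>i\<in>I. u i * v i j) + (1 - val p) * (\<Sum>i\<in>I. v' i * v i j)" if "j \<in> J" for j
      unfolding node.prems(3)[OF that] sum_distrib_left sum.distrib[symmetric]
      by (intro sum.cong) (auto simp: node algebra_simps)
  qed fact
qed

text \<open>The normal form behind uniqueness. At a node, both subtrees give up their copy of
  \<open>x i\<close>, and \<open>choice_common\<close> fuses the copies. For \<open>w i = 1\<close>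
  the remainder is left unconstrained, since rescaling its weights would divide by zero.\<close>

lemma mix_extract:
  "mix I x w e \<Longrightarrow> finite I \<Longrightarrow> i \<in> I \<Longrightarrow>
    \<exists>e'. e \<simeq> x i \<oplus>\<^bsub>prb (w i)\<^esub> e' \<and> (w i \<noteq> 1 \<longrightarrow> mix (I - {i}) x (\<lambda>j. w j / (1 - w i)) e')"
proof (induction rule: mix.induct)
  case (leaf k e w)
  show ?case
  proof (cases "k = i")
    case True
    then show ?thesis using leaf Trans[OF leaf(2) C2] by auto
  next
    case False
    then have [simp]: "w i = 0" using leaf by simp
    have "e \<simeq> x i \<oplus>\<^bsub>prb (w i)\<^esub> x k" using Trans[OF leaf(2) Sym[OF choice_0]] by simp
    moreover have "mix (I - {i}) x (\<lambda>j. w j / (1 - w i)) (x k)"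
      by (rule mix.leaf[of k]) (use False leaf in \<open>auto intro: Refl\<close>)
    ultimately show ?thesis by blast
  qed
next
  case (node u e v f g p w)
  obtain e' where e': "e \<simeq> x i \<oplus>\<^bsub>prb (u i)\<^esub> e'"
    "u i \<noteq> 1 \<Longrightarrow> mix (I - {i}) x (\<lambda>j. u j / (1 - u i)) e'" using node by auto
  obtain f' where f': "f \<simeq> x i \<oplus>\<^bsub>prb (v i)\<^esub> f'"
    "v i \<noteq> 1 \<Longrightarrow> mix (I - {i}) x (\<lambda>j. v j / (1 - v i)) f'" using node by auto
  have u: "sum u I = 1" "\<And>i. i \<in> I \<Longrightarrow> 0 \<le> u i" and v: "sum v I = 1" "\<And>i. i \<in> I \<Longrightarrow> 0 \<le> v i"
    using mix_sum[OF node(1)] mix_sum[OF node(2)] mix_nonneg[OF node(1)] mix_nonneg[OF node(2)] node(7)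
    by auto
  have ui: "0 \<le> u i" "u i \<le> 1" and vi: "0 \<le> v i" "v i \<le> 1"
    using u v weight_le_1[OF node(7) u node(8)] weight_le_1[OF node(7) v node(8)] node(8) by auto
  have wj: "w j = val p * u j + (1 - val p) * v j" if "j \<in> I" for j using node(4) that .
  note wi = wj[OF \<open>i \<in> I\<close>]
  have g: "g \<simeq> (x i \<oplus>\<^bsub>prb (u i)\<^esub> e') \<oplus>\<^bsub>p\<^esub> (x i \<oplus>\<^bsub>prb (v i)\<^esub> f')"
    by (rule Trans[OF node(3) cong_Choice[OF e'(1) f'(1)]])
  have le: "val p * u i \<le> val p" "(1 - val p) * v i \<le> 1 - val p"
    using ui vi by (auto intro: mult_left_le)
  show ?case
  proof (cases "w i = 1")
    case True
    \<comment> \<open>Total weight 1 on \<open>i\<close> forces each branch either to have weight 0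
      or to be concentrated on \<open>i\<close>.\<close>
    then have *: "val p * u i = val p" "(1 - val p) * v i = 1 - val p" using le wi by linarith+
    have "g \<simeq> x i"
    proof -
      consider "val p = 0" "v i = 1" | "val p = 1" "u i = 1" | "u i = 1" "v i = 1" using * by auto
      then show ?thesis
      proof cases
        case 1
        then have "p = prb 0" by (metis prb_val)
        with 1 g have "g \<simeq> (x i \<oplus>\<^bsub>prb (u i)\<^esub> e') \<oplus>\<^bsub>prb 0\<^esub> (x i \<oplus>\<^bsub>prb 1\<^esub> f')" by simp
        then show ?thesis by (rule Trans[OF _ Trans[OF choice_0 choice_1]])
      next
        case 2
        then have "p = prb 1" by (metis prb_val)
        with 2 g have "g \<simeq> (x i \<oplus>\<^bsub>prb 1\<^esub> e') \<oplus>\<^bsub>prb 1\<^esub> (x i \<oplus>\<^bsub>prb (v i)\<^esub> f')" by simp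
        then show ?thesis by (rule Trans[OF _ Trans[OF choice_1 choice_1]])
      next
        case 3
        with g have "g \<simeq> (x i \<oplus>\<^bsub>prb 1\<^esub> e') \<oplus>\<^bsub>p\<^esub> (x i \<oplus>\<^bsub>prb 1\<^esub> f')" by simp
        then show ?thesis
          by (rule Trans[OF _ Trans[OF cong_Choice[OF choice_1 choice_1] Sym[OF C1]]])
      qed
    qed
    \<comment> \<open>The second argument has weight 0, so any expression would serve in place of
      \<open>f'\<close>.\<close>
    then have "g \<simeq> x i \<oplus>\<^bsub>prb (w i)\<^esub> f'" unfolding True by (rule Trans[OF _ C2])
    then show ?thesis using True by blast
  next
    case False
    then have w1: "w i < 1" using le wi by linarith
    \<comment> \<open>The share of \<open>e'\<close> in what is left after \<open>x i\<close> is
      removed.\<close>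
    define t where "t = val p * (1 - u i) / (1 - w i)"
    have pu: "0 \<le> val p * (1 - u i)" "0 \<le> (1 - val p) * (1 - v i)"
      using ui vi by (auto intro: mult_nonneg_nonneg)
    have t1: "1 - t = (1 - val p) * (1 - v i) / (1 - w i)"
    proof -
      have "1 - t = ((1 - w i) - val p * (1 - u i)) / (1 - w i)"
        using w1 by (simp add: t_def diff_divide_distrib)
      also have "(1 - w i) - val p * (1 - u i) = (1 - val p) * (1 - v i)"
        unfolding wi by (simp add: algebra_simps)
      finally show ?thesis .
    qed
    have t: "0 \<le> t" "t \<le> 1"
    proof -
      show "0 \<le> t" using pu w1 by (simp add: t_def)
      have "0 \<le> 1 - t" unfolding t1 using pu w1 by simp
      then show "t \<le> 1" by simp
    qed
    have "g \<simeq> x i \<oplus>\<^bsub>prb (w i)\<^esub> (e' \<oplus>\<^bsub>prb t\<^esub> f')"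
      using Trans[OF g] choice_common[of "u i" "v i" "val p" "w i" t "x i" e' f'] ui vi wi w1
      by (simp add: t_def mult.commute)
    moreover have "mix (I - {i}) x (\<lambda>j. w j / (1 - w i)) (e' \<oplus>\<^bsub>prb t\<^esub> f')"
    proof -
      \<comment> \<open>If one branch is concentrated on \<open>i\<close>, nothing is known about
        its remainder, but that remainder has share 0 and the other one survives. Both branches at
        once would give \<open>w i = 1\<close>.\<close>
      consider "u i = 1" "v i \<noteq> 1" | "v i = 1" "u i \<noteq> 1" | "u i \<noteq> 1" "v i \<noteq> 1"
        using False wi by fastforce
      then show ?thesis
      proof cases
        case 1
        then have [simp]: "t = 0" by (simp add: t_def)
        have *: "1 - w i = (1 - val p) * (1 - v i)" using 1 wi by (simp add: algebra_simps)
        have "mix (I - {i}) x (\<lambda>j. w j / (1 - w i)) f'"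
        proof (rule mix_weight_cong[OF f'(2)[OF 1(2)]])
          fix j assume j: "j \<in> I - {i}"
          then have "u j = 0" using sum_1_concentrated[OF node(7) u node(8) 1(1)] by auto
          then have "w j = (1 - val p) * v j" using wj j by simp
          moreover have "1 - val p \<noteq> 0" using * w1 by auto
          ultimately show "w j / (1 - w i) = v j / (1 - v i)" unfolding * by simp
        qed
        then show ?thesis by (rule mix_equiv) (simp add: choice_0)
      next
        case 2
        then have [simp]: "t = 1" using t1 by simp
        have *: "1 - w i = val p * (1 - u i)" using 2 wi by (simp add: algebra_simps)
        have "mix (I - {i}) x (\<lambda>j. w j / (1 - w i)) e'"
        proof (rule mix_weight_cong[OF e'(2)[OF 2(2)]])
          fix j assume j: "j \<in> I - {i}"
          then have "v j = 0" using sum_1_concentrated[OF node(7) v node(8) 2(1)] by auto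
          then have "w j = val p * u j" using wj j by simp
          moreover have "val p \<noteq> 0" using * w1 by auto
          ultimately show "w j / (1 - w i) = u j / (1 - u i)" unfolding * by simp
        qed
        then show ?thesis by (rule mix_equiv) (simp add: choice_1)
      next
        case 3
        show ?thesis
        proof (rule mix.node[OF e'(2)[OF 3(1)] f'(2)[OF 3(2)] Refl])
          fix j assume "j \<in> I - {i}"
          then have "w j = val p * u j + (1 - val p) * v j" using wj by auto
          moreover have "t * (u j / (1 - u i)) = val p * u j / (1 - w i)"
            using 3 by (simp add: t_def)
          moreover have "(1 - t) * (v j / (1 - v i)) = (1 - val p) * v j / (1 - w i)"
            using 3 by (simp add: t1)
          ultimately show "w j / (1 - w i) =
              val (prb t) * (u j / (1 - u i)) + (1 - val (prb t)) * (v j / (1 - v i))"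
            using t by (simp add: add_divide_distrib)
        qed
      qed
    qed
    ultimately show ?thesis by blast
  qed
qed

text \<open>Pulling the same entry to the front of both sides leaves remainders with equal rescaled
  weights, to which induction applies. The empty family is impossible because weights sum to
  1.\<close>

lemma mix_unique:
  assumes "finite I" "mix I x w e" "mix I x w f"
  shows "e \<simeq> f"
  using assms
proof (induction I arbitrary: w e f rule: finite_induct)
  case empty
  then show ?case using mix_sum by fastforce
next
  case (insert i I)
  have fin: "finite (insert i I)" and *: "insert i I - {i} = I" using insert by auto
  obtain e' where e': "e \<simeq> x i \<oplus>\<^bsub>prb (w i)\<^esub> e'" "w i \<noteq> 1 \<Longrightarrow> mix I x (\<lambda>j. w j / (1 - w i)) e'"
    using mix_extract[OF insert(4) fin, of i] unfolding * by auto
  obtain f' where f': "f \<simeq> x i \<oplus>\<^bsub>prb (w i)\<^esub> f'" "w i \<noteq> 1 \<Longrightarrow> mix I x (\<lambda>j. w j / (1 - w i)) f'"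
    using mix_extract[OF insert(5) fin, of i] unfolding * by auto
  show ?case
  proof (cases "w i = 1")
    case True
    with e' f' have "e \<simeq> x i \<oplus>\<^bsub>prb 1\<^esub> e'" "f \<simeq> x i \<oplus>\<^bsub>prb 1\<^esub> f'" by simp_all
    then show ?thesis by (blast intro: Trans[OF Trans[OF _ choice_1] Sym[OF Trans[OF _ choice_1]]])
  next
    case False
    then have "e' \<simeq> f'" using insert.IH e' f' by blast
    then show ?thesis
      using Trans[OF Trans[OF e'(1) cong_Choice[OF Refl]] Sym[OF f'(1)]] by blast
  qed
qed

section \<open>Existence of convex combinations and n-ary choice\<close>

lemma mix_iff: "finite I \<Longrightarrow> mix I x w e \<Longrightarrow> mix I x w f \<longleftrightarrow> f \<simeq> e"
  by (metis mix_equiv mix_unique)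

text \<open>The link from syntax to weights, valid whichever index is split off first. Since the
  weights sum to exactly 1, and still do after rescaling, the recursion stops at an index of weight
  1 and never reaches \<open>Zero\<close>.\<close>

lemma mix_nchoice:
  assumes "finite I" "(\<Sum>i\<in>I. val (p i)) = 1"
  shows "mix I x (\<lambda>i. val (p i)) (nchoice I p x)"
  using assms
proof (induction "card I" arbitrary: I p rule: less_induct)
  case less
  have ne: "I \<noteq> {}" using less.prems by auto
  show ?case
  proof (cases "\<exists>k\<in>I. val (p k) = 1")
    case True
    define k where "k = (SOME k. k \<in> I \<and> val (p k) = 1)"
    have k: "k \<in> I" "val (p k) = 1" using someI_ex[OF True[unfolded Bex_def]] by (auto simp: k_def)
    have "nchoice I p x = x k"
      unfolding k_def by (subst nchoice.simps) (use True ne less.prems(1) in simp)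
    moreover have "mix I x (\<lambda>i. val (p i)) (x k)"
    proof (rule mix.leaf[OF k(1) Refl])
      show "val (p j) = of_bool (j = k)" if "j \<in> I" for j
        using sum_1_concentrated[OF less.prems val_nonneg k that] k(2) by (cases "j = k") auto
    qed
    ultimately show ?thesis by simp
  next
    case False
    define k where "k = (SOME k. k \<in> I)"
    have k: "k \<in> I" using ne by (simp add: k_def some_in_eq)
    define q where "q i = prb (val (p i) / (1 - val (p k)))" for i
    have pk: "val (p k) < 1" using False k by (auto simp: less_le)
    have sum: "(\<Sum>i\<in>I - {k}. val (p i)) = 1 - val (p k)" using less.prems k by (simp add: sum_diff1)
    \<comment> \<open>The rescaled weight lies in the unit interval, so \<open>prb\<close> does not
      distort it.\<close>
    have q: "val (q i) = val (p i) / (1 - val (p k))" if "i \<in> I - {k}" for i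
    proof -
      have "val (p i) \<le> 1 - val (p k)"
        unfolding sum[symmetric] by (rule member_le_sum) (use that less.prems in auto)
      then show ?thesis using pk by (simp add: q_def)
    qed
    have "(\<Sum>i\<in>I - {k}. val (q i)) = 1"
      using pk by (simp add: q sum flip: sum_divide_distrib)
    then have "mix (I - {k}) x (\<lambda>i. val (q i)) (nchoice (I - {k}) q x)"
      using less.prems k by (intro less.hyps card_Diff1_less) auto
    then have 2: "mix I x (\<lambda>i. if i = k then 0 else val (q i)) (nchoice (I - {k}) q x)"
      by (rule mix_mono) auto
    have 1: "mix I x (\<lambda>i. of_bool (i = k)) (x k)" by (rule mix.leaf[OF k Refl]) auto
    have "nchoice I p x = x k \<oplus>\<^bsub>p k\<^esub> nchoice (I - {k}) q x"
      unfolding k_def q_def [abs_def]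
      by (subst nchoice.simps) (use False ne less.prems(1) in \<open>simp add: Let_def\<close>)
    then show ?thesis
      by simp (rule mix.node[OF 1 2 Refl], use q pk in auto)
  qed
qed

lemma mix_exists:
  assumes "finite I" "\<And>i. i \<in> I \<Longrightarrow> 0 \<le> w i" "sum w I = 1"
  shows "\<exists>e. mix I x w e"
proof -
  have [simp]: "val (prb (w i)) = w i" if "i \<in> I" for i
    using that assms weight_le_1[of I w i] by simp
  have "mix I x (\<lambda>i. val (prb (w i))) (nchoice I (\<lambda>i. prb (w i)) x)"
    by (rule mix_nchoice) (use assms in auto)
  then have "mix I x w (nchoice I (\<lambda>i. prb (w i)) x)"
    by (rule mix_weight_cong) simp
  then show ?thesis ..
qed

text \<open>Both sides are flattened to two copies of \<open>J\<close>, one carrying the entries \<open>x\<close> and the other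
  the entries \<open>y\<close>.\<close>

lemma mix_merge:
  assumes "finite J" "i \<notin> J"
    and x: "mix (insert i J) x w e"
    and y: "mix J y w' (x i)"
    and z: "\<And>j. j \<in> J \<Longrightarrow> z j \<simeq> x j \<oplus>\<^bsub>prb (w j / (w j + w i * w' j))\<^esub> y j"
  shows "mix J z (\<lambda>j. w j + w i * w' j) e"
proof -
  define v where "v j = w j + w i * w' j" for j
  define K where "K = J <+> J"
  define k where "k = case_sum x y"
  define W where "W = case_sum w (\<lambda>j. w i * w' j)"
  have w: "\<And>j. j \<in> J \<Longrightarrow> 0 \<le> w j" "0 \<le> w i" "w i + sum w J = 1"
    using mix_nonneg[OF x] mix_sum[OF x] assms by auto
  have w': "\<And>j. j \<in> J \<Longrightarrow> 0 \<le> w' j" "sum w' J = 1"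
    using mix_nonneg[OF y] mix_sum[OF y] assms by auto
  have "sum v J = 1"
    using w w' by (simp add: v_def sum.distrib flip: sum_distrib_left)
  \<comment> \<open>Any combination \<open>f\<close> of the fused entries with the target weights
    will do: \<open>e\<close> and \<open>f\<close> get the same weights over the common family
    \<open>k\<close>, so \<open>e \<simeq> f\<close>.\<close>
  then obtain f where f: "mix J z v f"
    using mix_exists[of J v z] w w' assms by (auto simp: v_def)
  have left: "mix K k (\<lambda>m. of_bool (m = Inl j)) (x j)" if "j \<in> J" for j
    by (rule leaf[of "Inl j"]) (use that in \<open>auto simp: K_def k_def Refl\<close>)
  have right: "mix K k (\<lambda>m. of_bool (m = Inr j)) (y j)" if "j \<in> J" for j
    by (rule leaf[of "Inr j"]) (use that in \<open>auto simp: K_def k_def Refl\<close>)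
  have yi: "mix K k (case_sum (\<lambda>_. 0) w') (x i)"
    by (rule mix_flatten[OF y \<open>finite J\<close> right])
      (use \<open>finite J\<close> in \<open>auto simp: K_def of_bool_def if_distrib cong: if_cong\<close>)
  have eK: "mix K k W e"
  \<comment> \<open>The entry \<open>x i\<close> is spread over the second copy of \<open>J\<close>;
    every other \<open>x j\<close> stays a single leaf in the first.\<close>
  proof (rule mix_flatten[OF x, where v = "\<lambda>j m. if j = i then case_sum (\<lambda>_. 0) w' m else of_bool (m = Inl j)"])
    show "mix K k (\<lambda>m. if j = i then case_sum (\<lambda>_. 0) w' m else of_bool (m = Inl j)) (x j)"
      if "j \<in> insert i J" for j
      using that yi left assms by (cases "j = i") auto
    fix m assume m: "m \<in> K"
    have "(\<Sum>j\<in>J. w j * (if j = i then case_sum (\<lambda>_. 0) w' m else of_bool (m = Inl j)))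
        = (\<Sum>j\<in>J. if m = Inl j then w j else 0)"
      using assms by (intro sum.cong) auto
    also have "\<dots> = case_sum w (\<lambda>_. 0) m"
      using m assms by (auto simp: K_def)
    finally show "W m = (\<Sum>j\<in>insert i J. w j * (if j = i then case_sum (\<lambda>_. 0) w' m else of_bool (m = Inl j)))"
      using assms by (auto simp: W_def split: sum.split)
  qed (use assms in auto)
  have fK: "mix K k W f"
  proof (rule mix_flatten[OF f \<open>finite J\<close>, where
        v = "\<lambda>j m. w j / v j * of_bool (m = Inl j) + (1 - w j / v j) * of_bool (m = Inr j)"])
    show "mix K k (\<lambda>m. w j / v j * of_bool (m = Inl j) + (1 - w j / v j) * of_bool (m = Inr j)) (z j)"
      if "j \<in> J" for j
    proof (rule node[OF left[OF that] right[OF that] z[OF that]])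
      have "0 \<le> w j" "w j \<le> v j" using w w' that by (auto simp: v_def)
      then have "0 \<le> w j / v j" "w j / v j \<le> 1" by (auto intro: divide_le_eq_1[THEN iffD2])
      then show "w j / v j * of_bool (m = Inl j) + (1 - w j / v j) * of_bool (m = Inr j) =
          val (prb (w j / (w j + w i * w' j))) * of_bool (m = Inl j) +
          (1 - val (prb (w j / (w j + w i * w' j)))) * of_bool (m = Inr j)" for m
        by (simp add: v_def)
    qed
    fix m assume m: "m \<in> K"
    \<comment> \<open>Where the target weight is 0 the quotient defaults to 0; by nonnegativity both
      contributions vanish there, so the weights still agree.\<close>
    have v0: "w j = 0 \<and> w i * w' j = 0" if "j \<in> J" "v j = 0" for j
      using that w w' by (auto simp: v_def add_nonneg_eq_0_iff)
    have "(\<Sum>j\<in>J. v j * (w j / v j * of_bool (m = Inl j) + (1 - w j / v j) * of_bool (m = Inr j)))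
        = (\<Sum>j\<in>J. (if m = Inl j then w j else 0) + (if m = Inr j then w i * w' j else 0))"
      using v0 by (intro sum.cong) (auto simp: right_diff_distrib, auto simp: v_def)
    also have "\<dots> = W m"
      using m assms by (auto simp: K_def W_def sum.distrib)
    finally show "W m = (\<Sum>j\<in>J. v j * (w j / v j * of_bool (m = Inl j) + (1 - w j / v j) * of_bool (m = Inr j)))"
      by simp
  qed
  have "finite K" using assms by (simp add: K_def)
  then have "e \<simeq> f" using mix_unique eK fK by blast
  then show ?thesis using f mix_equiv by (auto simp: v_def [abs_def])
qed

section \<open>Elimination of unknowns\<close>

text \<open>The right-hand side of one equation under the assignment \<open>h\<close>. A relation
  instead of an \<open>nchoice\<close> term lets weights be changed arithmetically, without tracking
  the order of splitting.\<close>

definition row ::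
  "'q set \<Rightarrow> ('q \<Rightarrow> 'a pexp) \<Rightarrow> ('q \<Rightarrow> real) \<Rightarrow> 'a pexp \<Rightarrow> real \<Rightarrow> ('q \<Rightarrow> 'a pexp) \<Rightarrow> 'a pexp \<Rightarrow> bool"
  where
  "row Q M p b r h = mix (Q <+> {()}) (case_sum (\<lambda>q. M q ;; h q) (\<lambda>_. b)) (case_sum p (\<lambda>_. r))"

lemma sum_Plus_unit: "finite Q \<Longrightarrow> sum f (Q <+> {()}) = (\<Sum>q\<in>Q. f (Inl q)) + (f (Inr ()) :: real)"
  by (simp add: sum.Plus)

section \<open>Right-hand sides exist and are determined up to equivalence\<close>

lemma row_exists:
  assumes "finite Q" "\<And>q. q \<in> Q \<Longrightarrow> 0 \<le> p q" "0 \<le> r" "sum p Q + r = 1"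
  shows "\<exists>e. row Q M p b r h e"
  unfolding row_def by (rule mix_exists) (use assms in \<open>auto simp: sum_Plus_unit\<close>)

lemma row_cong:
  assumes "row Q M p b r h e" "\<And>q. q \<in> Q \<Longrightarrow> h q \<simeq> g q"
  shows "row Q M p b r g e"
  using assms unfolding row_def by (auto elim!: mix_cong intro!: cong_Seq Refl)

lemma row_iff: "finite Q \<Longrightarrow> row Q M p b r h e \<Longrightarrow> row Q M p b r h f \<longleftrightarrow> f \<simeq> e"
  unfolding row_def by (simp add: mix_iff)

section \<open>Solving one equation and substituting the result\<close>

lemma insert_Plus: "insert u Q <+> B = insert (Inl u) (Q <+> B)"
  by auto

text \<open>(Unique) gives one direction, (Unroll) with (D1) the other, so solving for an unknown
  neither loses nor adds solutions.\<close>

lemma loop_fixpoint_iff: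
  assumes "E m = 0"
  shows "g \<simeq> (m ;; g) \<oplus>\<^bsub>t\<^esub> f \<longleftrightarrow> g \<simeq> Loop m t ;; f"
proof
  assume g: "g \<simeq> Loop m t ;; f"
  have "Loop m t ;; f \<simeq> ((m ;; Loop m t) \<oplus>\<^bsub>t\<^esub> One) ;; f"
    by (rule cong_Seq[OF Sym[OF Unroll] Refl])
  also have "\<dots> \<simeq> ((m ;; Loop m t) ;; f) \<oplus>\<^bsub>t\<^esub> (One ;; f)" by (rule D1)
  also have "\<dots> \<simeq> (m ;; g) \<oplus>\<^bsub>t\<^esub> f"
    by (rule cong_Choice[OF Trans[OF Sym[OF Assoc] cong_Seq[OF Refl Sym[OF g]]] OneSeq])
  finally show "g \<simeq> (m ;; g) \<oplus>\<^bsub>t\<^esub> f" by (rule Trans[OF g])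
qed (use assms Unique in blast)

text \<open>If \<open>p u = 1\<close>, the rest of the row has weight 0 and the division returns 0; \<open>b\<close> then takes
  the whole weight, so that the rescaled row is again a probability distribution.\<close>

definition solved_p :: "'q \<Rightarrow> ('q \<Rightarrow> real) \<Rightarrow> 'q \<Rightarrow> real" where
  "solved_p u p q = p q / (1 - p u)"

definition solved_r :: "'q \<Rightarrow> ('q \<Rightarrow> real) \<Rightarrow> real \<Rightarrow> real" where
  "solved_r u p r = (if p u = 1 then 1 else r / (1 - p u))"

lemma solved_weights:
  assumes "finite Q" "u \<notin> Q" "\<And>q. q \<in> insert u Q \<Longrightarrow> 0 \<le> p q" "0 \<le> r" "sum p (insert u Q) + r = 1"
  shows "p u \<le> 1" "\<And>q. q \<in> Q \<Longrightarrow> 0 \<le> solved_p u p q" "0 \<le> solved_r u p r"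
    "sum (solved_p u p) Q + solved_r u p r = 1"
    "\<And>q. q \<in> Q \<Longrightarrow> (1 - p u) * solved_p u p q = p q" "(1 - p u) * solved_r u p r = r"
proof -
  have *: "sum p Q + r = 1 - p u" "0 \<le> sum p Q" using assms by (auto intro: sum_nonneg)
  show pu: "p u \<le> 1" using * assms by linarith
  show "\<And>q. q \<in> Q \<Longrightarrow> 0 \<le> solved_p u p q" "0 \<le> solved_r u p r"
    using pu assms by (auto simp: solved_p_def solved_r_def)
  show "sum (solved_p u p) Q + solved_r u p r = 1"
  proof (cases "p u = 1")
    case False
    then show ?thesis
      by (simp add: solved_p_def solved_r_def * flip: sum_divide_distrib add_divide_distrib)
  qed (simp add: solved_p_def solved_r_def)
  \<comment> \<open>At \<open>p u = 1\<close> the remaining weights are nonnegative with sum 0, so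
    the default values in the rescaled row are multiplied away correctly.\<close>
  have 0: "p u = 1 \<Longrightarrow> r = 0 \<and> sum p Q = 0" using * assms by auto
  then show "(1 - p u) * solved_r u p r = r" by (simp add: solved_r_def)
  show "(1 - p u) * solved_p u p q = p q" if "q \<in> Q" for q
  proof (cases "p u = 1")
    case True
    then have "p q = 0" using 0 that assms by (simp add: sum_nonneg_eq_0_iff)
    then show ?thesis by (simp add: solved_p_def)
  qed (simp add: solved_p_def)
qed

text \<open>Splitting the row at its root into the summand of \<open>u\<close> and the rescaled rest
  \<open>F\<close> gives a fixpoint equation for \<open>g u\<close>. As \<open>F\<close> is a row
  over \<open>Q\<close> alone, \<open>u\<close> no longer enters the right-hand side.\<close>

lemma row_solve_iff:
  assumes "finite Q" "u \<notin> Q" "\<And>q. q \<in> insert u Q \<Longrightarrow> 0 \<le> p q" "0 \<le> r" "sum p (insert u Q) + r = 1"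
    and "E (M u) = 0"
    and F: "row Q M (solved_p u p) b (solved_r u p r) g F"
  shows "row (insert u Q) M p b r g (g u) \<longleftrightarrow> g u \<simeq> Loop (M u) (prb (p u)) ;; F"
proof -
  note sw = solved_weights[OF assms(1-5)]
  have ne: "q = u \<longleftrightarrow> False" if "q \<in> Q" for q using that assms by auto
  let ?x = "case_sum (\<lambda>q. M q ;; g q) (\<lambda>_. b)"
  have "row (insert u Q) M p b r g ((M u ;; g u) \<oplus>\<^bsub>prb (p u)\<^esub> F)"
    unfolding row_def
  proof (rule mix.node)
    show "mix (insert u Q <+> {()}) ?x (\<lambda>j. of_bool (j = Inl u)) (M u ;; g u)"
      by (rule mix.leaf[of "Inl u"]) (auto intro: Refl)
    show "mix (insert u Q <+> {()}) ?x
        (case_sum (\<lambda>q. if q = u then 0 else solved_p u p q) (\<lambda>_. solved_r u p r)) F"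
      using F unfolding row_def by (rule mix_mono) (use assms in auto)
    show "(M u ;; g u) \<oplus>\<^bsub>prb (p u)\<^esub> F \<simeq> (M u ;; g u) \<oplus>\<^bsub>prb (p u)\<^esub> F" by (rule Refl)
  qed (use sw(1,5,6) assms(3)[of u] ne in auto)
  then have "row (insert u Q) M p b r g (g u) \<longleftrightarrow> g u \<simeq> (M u ;; g u) \<oplus>\<^bsub>prb (p u)\<^esub> F"
    by (rule row_iff[rotated]) (use assms(1) in simp)
  also have "\<dots> \<longleftrightarrow> g u \<simeq> Loop (M u) (prb (p u)) ;; F" by (rule loop_fixpoint_iff) fact
  finally show ?thesis .
qed

text \<open>By (D2), substituting for \<open>g u\<close> multiplies the solved row by
  \<open>M u ;; l\<close> on the left. The two coefficients of each \<open>g q\<close> are then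
  collected by (D1), weighted by their shares in the new total.\<close>

lemma row_substitute_iff:
  fixes M :: "'q \<Rightarrow> 'a pexp"
  assumes "finite Q" "u \<notin> Q" "\<And>q. q \<in> insert u Q \<Longrightarrow> 0 \<le> p q" "0 \<le> r" "sum p (insert u Q) + r = 1"
    and F: "row Q N p' c r' g F" and gu: "g u \<simeq> l ;; F"
  shows "row (insert u Q) M p b r g e \<longleftrightarrow>
    row Q (\<lambda>q. M q \<oplus>\<^bsub>prb (p q / (p q + p u * p' q))\<^esub> (M u ;; l ;; N q)) (\<lambda>q. p q + p u * p' q)
      (b \<oplus>\<^bsub>prb (r / (r + p u * r'))\<^esub> (M u ;; l ;; c)) (r + p u * r') g e"
    (is "_ \<longleftrightarrow> row Q ?M ?p ?b ?r g e")
proof -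
  \<comment> \<open>A row determines its right-hand side up to \<open>\<simeq>\<close>, so a single
    \<open>f\<close> satisfying both rows proves the equivalence.\<close>
  obtain f where f: "row (insert u Q) M p b r g f"
    using row_exists[of "insert u Q" p r M b g] assms by auto
  have "row Q ?M ?p ?b ?r g f"
    unfolding row_def
  proof (rule mix_weight_cong[OF mix_merge])
    let ?x = "case_sum (\<lambda>q. M q ;; g q) (\<lambda>_. b)"
    let ?y = "case_sum (\<lambda>q. M u ;; l ;; (N q ;; g q)) (\<lambda>_. M u ;; l ;; c)"
    let ?w = "case_sum p (\<lambda>_. r)" and ?w' = "case_sum p' (\<lambda>_. r')"
    show "mix (insert (Inl u) (Q <+> {()})) ?x ?w f"
      using f unfolding row_def insert_Plus .
    have "mix (Q <+> {()}) ?y ?w' ((M u ;; l) ;; F)"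
      using F unfolding row_def
      by (rule mix_seq_left) (auto intro: Assoc)
    moreover have "?x (Inl u) \<simeq> (M u ;; l) ;; F"
      using Trans[OF cong_Seq[OF Refl gu] Assoc] by simp
    ultimately show "mix (Q <+> {()}) ?y ?w' (?x (Inl u))" by (rule mix_equiv)
    fix j assume j: "j \<in> Q <+> {()}"
    show "case_sum ?p (\<lambda>_. ?r) j = ?w j + ?w (Inl u) * ?w' j" by (cases j) auto
    have "(M u ;; l ;; N q) ;; g q \<simeq> M u ;; l ;; (N q ;; g q)" for q
      by (rule Trans[OF cong_Seq[OF Assoc Refl] Trans[OF Sym[OF Assoc] Sym[OF Assoc]]])
    then have "?M q ;; g q \<simeq> (M q ;; g q) \<oplus>\<^bsub>prb (p q / ?p q)\<^esub> (M u ;; l ;; (N q ;; g q))" for q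
      by (intro Trans[OF D1] cong_Choice Refl)
    then show "case_sum (\<lambda>q. ?M q ;; g q) (\<lambda>_. ?b) j \<simeq>
        ?x j \<oplus>\<^bsub>prb (?w j / (?w j + ?w (Inl u) * ?w' j))\<^esub> ?y j"
      using j by (cases j) (auto intro: Refl)
  qed (use assms in auto)
  from row_iff[OF assms(1) this] show ?thesis using row_iff[OF _ f] assms(1) by simp
qed

text \<open>One \<open>h\<close> characterising all solutions expresses existence and uniqueness at
  once. This form passes through the induction because solutions restrict to solutions of the
  reduced system, and the value at \<open>u\<close> is recovered from the others.\<close>

lemma elimination:
  fixes M :: "'q \<Rightarrow> 'q \<Rightarrow> 'a pexp"
  assumes "finite Q" "\<And>q q'. q \<in> Q \<Longrightarrow> q' \<in> Q \<Longrightarrow> 0 \<le> p q q'" "\<And>q. q \<in> Q \<Longrightarrow> 0 \<le> r q"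
    "\<And>q. q \<in> Q \<Longrightarrow> sum (p q) Q + r q = 1" "\<And>q q'. q \<in> Q \<Longrightarrow> q' \<in> Q \<Longrightarrow> E (M q q') = 0"
  shows "\<exists>h. \<forall>g. (\<forall>q\<in>Q. row Q (M q) (p q) (b q) (r q) g (g q)) \<longleftrightarrow> (\<forall>q\<in>Q. g q \<simeq> h q)"
  using assms
proof (induction Q arbitrary: M p b r rule: finite_induct)
  case empty
  then show ?case by simp
next
  case (insert u Q)
  define p' where "p' = solved_p u (p u)"
  define r' where "r' = solved_r u (p u) (r u)"
  define l where "l = Loop (M u u) (prb (p u u))"
  have sw: "\<And>q. q \<in> Q \<Longrightarrow> 0 \<le> p' q" "0 \<le> r'" "sum p' Q + r' = 1"
    using solved_weights[of Q u "p u" "r u"] insert.prems insert.hyps by (auto simp: p'_def r'_def)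
  \<comment> \<open>The solved row of \<open>u\<close> depends on the values of \<open>g\<close> on
    \<open>Q\<close>, so one right-hand side is picked for each \<open>g\<close>.\<close>
  define F where "F g = (SOME e. row Q (M u) p' (b u) r' g e)" for g
  have F: "row Q (M u) p' (b u) r' g (F g)" for g
    unfolding F_def by (rule someI_ex, rule row_exists) (use insert.hyps sw in auto)
  define M2 where "M2 q q' = M q q' \<oplus>\<^bsub>prb (p q q' / (p q q' + p q u * p' q'))\<^esub> (M q u ;; l ;; M u q')" for q q'
  define p2 where "p2 q q' = p q q' + p q u * p' q'" for q q'
  define b2 where "b2 q = b q \<oplus>\<^bsub>prb (r q / (r q + p q u * r'))\<^esub> (M q u ;; l ;; b u)" for q
  define r2 where "r2 q = r q + p q u * r'" for q
  have "\<exists>h. \<forall>g. (\<forall>q\<in>Q. row Q (M2 q) (p2 q) (b2 q) (r2 q) g (g q)) \<longleftrightarrow> (\<forall>q\<in>Q. g q \<simeq> h q)"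
  proof (rule insert.IH)
    fix q assume q: "q \<in> Q"
    have "sum (p2 q) Q + r2 q = sum (p q) Q + r q + p q u * (sum p' Q + r')"
      by (simp add: p2_def r2_def sum.distrib distrib_left flip: sum_distrib_left)
    also have "\<dots> = 1" using sw insert.prems(3)[of q] insert.hyps q by simp
    finally show "sum (p2 q) Q + r2 q = 1" .
  \<comment> \<open>The new coefficients have termination 0: in the substituted summand the factor
    \<open>M q u\<close> already has it.\<close>
  qed (use insert.prems sw in \<open>auto simp: p2_def r2_def M2_def\<close>)
  then obtain h where
    h: "\<And>g. (\<forall>q\<in>Q. row Q (M2 q) (p2 q) (b2 q) (r2 q) g (g q)) \<longleftrightarrow> (\<forall>q\<in>Q. g q \<simeq> h q)" by blast
  have u_iff: "row (insert u Q) (M u) (p u) (b u) (r u) g (g u) \<longleftrightarrow> g u \<simeq> l ;; F g" for g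
    unfolding l_def by (rule row_solve_iff) (use insert.prems insert.hyps F in \<open>auto simp: p'_def r'_def\<close>)
  have Q_iff: "row (insert u Q) (M q) (p q) (b q) (r q) g e \<longleftrightarrow>
      row Q (M2 q) (p2 q) (b2 q) (r2 q) g e" if "q \<in> Q" "g u \<simeq> l ;; F g" for q g e
    unfolding M2_def [abs_def] p2_def [abs_def] b2_def r2_def
    by (rule row_substitute_iff[OF _ _ _ _ _ F that(2)]) (use insert.prems insert.hyps that in auto)
  \<comment> \<open>This frees the condition at \<open>u\<close> from \<open>g\<close>, as the
    witness \<open>h(u := l ;; F h)\<close> requires.\<close>
  have F_cong: "l ;; F g \<simeq> l ;; F h" if "\<forall>q\<in>Q. g q \<simeq> h q" for g
  proof -
    have "row Q (M u) p' (b u) r' h (F g)" by (rule row_cong[OF F]) (use that in simp)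
    then show ?thesis using row_iff[OF insert.hyps(1) F] by (intro cong_Seq[OF Refl]) simp
  qed
  have "(\<forall>q\<in>insert u Q. row (insert u Q) (M q) (p q) (b q) (r q) g (g q)) \<longleftrightarrow>
      (\<forall>q\<in>insert u Q. g q \<simeq> (h(u := l ;; F h)) q)" for g
  proof -
    have "(\<forall>q\<in>insert u Q. row (insert u Q) (M q) (p q) (b q) (r q) g (g q)) \<longleftrightarrow>
        g u \<simeq> l ;; F g \<and> (\<forall>q\<in>Q. g q \<simeq> h q)"
      using u_iff Q_iff h[of g] by auto
    also have "\<dots> \<longleftrightarrow> g u \<simeq> l ;; F h \<and> (\<forall>q\<in>Q. g q \<simeq> h q)"
      by (auto intro: Trans[OF _ F_cong] Trans[OF _ Sym[OF F_cong]])
    also have "\<dots> \<longleftrightarrow> (\<forall>q\<in>insert u Q. g q \<simeq> (h(u := l ;; F h)) q)"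
      using insert.hyps(2) by (auto simp: fun_upd_def)
    finally show ?thesis .
  qed
  then show ?case by blast
qed

section \<open>Existence and uniqueness of solutions of left-affine systems\<close>

theorem theorem7p6:
  fixes Q :: "'q set"
    and M :: "'q \<Rightarrow> 'q \<Rightarrow> 'a::finite pexp"
    and p :: "'q \<Rightarrow> 'q \<Rightarrow> prob"
    and b :: "'q \<Rightarrow> 'a pexp"
    and r :: "'q \<Rightarrow> prob"
  assumes "finite Q"
    and "left_affine Q M p b r"
  shows "(\<exists>h. is_solution Q M p b r h) \<and>
    (\<forall>h g. is_solution Q M p b r h \<longrightarrow> is_solution Q M p b r g \<longrightarrow> (\<forall>q\<in>Q. h q \<simeq> g q))"
proof -
  let ?p = "\<lambda>q q'. val (p q q')" and ?r = "\<lambda>q. val (r q)"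
  \<comment> \<open>The n-ary choice realises the weights of the row, and a row fixes an equivalence
    class, so \<open>row\<close> and the equations of \<open>is_solution\<close> coincide.\<close>
  have row: "row Q (M q) (?p q) (b q) (?r q) g e \<longleftrightarrow>
      e \<simeq> nchoice (Q <+> {()}) (case_sum (p q) (\<lambda>_. r q)) (case_sum (\<lambda>q'. M q q' ;; g q') (\<lambda>_. b q))"
    if "q \<in> Q" for q g e
  proof -
    have w: "case_sum (?p q) (\<lambda>_. ?r q) = (\<lambda>j. val (case_sum (p q) (\<lambda>_. r q) j))"
      by (auto split: sum.split)
    show ?thesis
      unfolding row_def w
      by (intro mix_iff mix_nchoice) (use assms that in \<open>auto simp: sum_Plus_unit left_affine_def\<close>)
  qed
  obtain h where "\<And>g. (\<forall>q\<in>Q. row Q (M q) (?p q) (b q) (?r q) g (g q)) \<longleftrightarrow> (\<forall>q\<in>Q. g q \<simeq> h q)"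
    using elimination[of Q ?p ?r M b] assms by (auto simp: left_affine_def)
  then have "is_solution Q M p b r g \<longleftrightarrow> (\<forall>q\<in>Q. g q \<simeq> h q)" for g
    using row by (simp add: is_solution_def)
  then show ?thesis by (blast intro: Refl Trans[OF _ Sym])
qed

end
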